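(* Let $p\in(0,1/2)$, $\rho=p/(1-p)$, and let $(C_k,M_k)$ be the cat and mouse Markov chain on $\mathbb{N}^2$ associated with the reflected simple random walk on $\mathbb{N}$. If $M_0=C_0=0$, then for any $s,t>0$ with $s<t$, the relation $$\lim_{n\to+\infty}\mathbb{P}\Bigl(\sup_{s\le u\le t}\frac{M_{\lfloor u\rho^{-n}\rfloor}}{n}\ge\frac12\Bigr)=1$$ holds.
   Context: $\mathbb{N}=\{0,1,2,\dots\}$. The cat and mouse Markov chain associated with a transition matrix $P=(p(x,y))$ on a discrete set ${\cal S}$ is the Markov chain on ${\cal S}\times{\cal S}$ with transition matrix $q[(x,y),(z,y)]=p(x,z)$ if $x\neq y$, and $q[(y,y),(z,w)]=p(y,z)p(y,w)$, for $x,y,z,w\in{\cal S}$; all other transitions have probability $0$. The reflected simple random walk on $\mathbb{N}$ has transition matrix $p(x,x+1)=p$ for $x\ge0$, $p(x,x-1)=1-p$ for $x\neq0$, $p(0,0)=1-p$. *)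

theory Defs
  imports "HOL-Probability.Probability"
begin

locale discrete_markov_chain = prob_space +
  fixes P :: "'s::countable \<Rightarrow> 's \<Rightarrow> real" and X :: "nat \<Rightarrow> 'a \<Rightarrow> 's"
  assumes random_variable_X: "\<And>k. X k \<in> M \<rightarrow>\<^sub>M count_space UNIV"
    and transition_X:
      "\<And>k x y. \<P>(\<omega> in M. \<forall>i\<le>k. X i \<omega> = x i) > 0 \<Longrightarrow>
        \<P>(\<omega> in M. X (Suc k) \<omega> = y \<bar> \<forall>i\<le>k. X i \<omega> = x i) = P (x k) y"

text \<open>States are pairs (cat, mouse).\<close>

definition cat_mouse :: "('s \<Rightarrow> 's \<Rightarrow> real) \<Rightarrow> 's \<times> 's \<Rightarrow> 's \<times> 's \<Rightarrow> real" where
  "cat_mouse P = (\<lambda>(x, y) (z, w).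
     if x = y then P y z * P y w
     else if w = y then P x z
     else 0)"

definition reflected_walk :: "real \<Rightarrow> nat \<Rightarrow> nat \<Rightarrow> real" where
  "reflected_walk p x y =
     (if y = x + 1 then p
      else if x \<noteq> 0 \<and> y = x - 1 then 1 - p
      else if x = 0 \<and> y = 0 then 1 - p
      else 0)"

end

theory Submission
  imports Defs
begin

text \<open>
  The mouse climbs to level \<open>n / 2\<close> from anywhere below it on a time scale much shorter than
  \<open>\<rho> ^ (-n)\<close>, so a window of length \<open>(t - s) * \<rho> ^ (-n)\<close> leaves it ample time, whatever the state at
  the beginning of the window.

  The climb is measured by a Foster--Lyapunov potential: a nonnegative function of the state that
  decreases by at least 1 on average at each step, as long as the mouse is below the level. Its value
  at the start then bounds the expected climbing time (\<open>foster_staying_bound\<close>). The potential has two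
  parts. While cat and mouse are apart only the cat moves, and \<open>chase\<close> bounds the time until it
  reaches the mouse: linear in the distance if the cat has to go down, and exponential in the height
  of the mouse if it has to climb against its drift. When they meet, the mouse makes one step of the
  reflected walk, and the chase that follows costs at most a constant times \<open>r ^ m\<close>, where \<open>m\<close> is the
  height of the mouse. For \<open>r > 1 / \<rho>\<close> the function \<open>x \<mapsto> r ^ x\<close> grows on average by a fixed factor at
  each step of the reflected walk (\<open>power_growth\<close>), so a large multiple of \<open>r ^ N - r ^ m\<close> pays for
  all the chases before the mouse reaches level \<open>N\<close> (\<open>potential_drift\<close>).

  It remains to bound the potential at the beginning \<open>T\<close> of the window. Below level \<open>N\<close> it is at most
  a constant times \<open>r ^ N\<close> plus a multiple of the height of the cat, and the cat is at most of order
  \<open>sqrt T\<close> high (\<open>cat_second_moment\<close>). With \<open>N\<close> about \<open>n / 2\<close>, all this is negligible with respect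
  to \<open>\<rho> ^ (-n)\<close> as soon as \<open>r < 1 / \<rho> ^ 2\<close>. The exponent \<open>r\<close> may thus be any number strictly between
  \<open>1 / \<rho>\<close> and \<open>1 / \<rho> ^ 2\<close>.
\<close>

section \<open>Expected drift along a discrete Markov chain\<close>

lemma (in prob_space) nn_integral_countable_valued:
  fixes Z :: "'a \<Rightarrow> 'c::countable" and f :: "'c \<Rightarrow> ennreal"
  assumes Z: "Z \<in> M \<rightarrow>\<^sub>M count_space UNIV"
  shows "(\<integral>\<^sup>+\<omega>. f (Z \<omega>) \<partial>M) =
    (\<integral>\<^sup>+z. emeasure M {\<omega> \<in> space M. Z \<omega> = z} * f z \<partial>count_space UNIV)"
proof -
  have law: "distr M (count_space UNIV) Z =
      density (count_space UNIV) (\<lambda>z. emeasure M {\<omega> \<in> space M. Z \<omega> = z})"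
    by (rule measure_eqI_countable[where A=UNIV])
      (auto simp: emeasure_distr[OF Z] emeasure_density nn_integral_count_space_indicator
        intro!: arg_cong[where f="emeasure M"])
  have "(\<integral>\<^sup>+\<omega>. f (Z \<omega>) \<partial>M) = (\<integral>\<^sup>+z. f z \<partial>distr M (count_space UNIV) Z)"
    by (simp add: nn_integral_distr[OF Z])
  then show ?thesis
    by (simp add: law nn_integral_density)
qed

context discrete_markov_chain
begin

text \<open>The Markov property is known only for conditioning on complete histories, and these, as lists over a
  countable type, take countably many values. Integrals can therefore be evaluated history by
  history.\<close>

definition history :: "nat \<Rightarrow> 'a \<Rightarrow> 's list" where
  "history k \<omega> = map (\<lambda>i. X i \<omega>) [0..<Suc k]"

lemma history_eq_iff: "history k \<omega> = xs \<longleftrightarrow> length xs = Suc k \<and> (\<forall>i\<le>k. X i \<omega> = xs ! i)"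
  unfolding history_def by (auto simp: list_eq_iff_nth_eq less_Suc_eq_le nth_append simp del: upt_Suc)

lemma history_nth: "i \<le> k \<Longrightarrow> history k \<omega> ! i = X i \<omega>"
  unfolding history_def by (simp del: upt_Suc)

lemma measurable_X_eq [measurable]: "Measurable.pred M (\<lambda>\<omega>. X i \<omega> = x)"
  using random_variable_X[of i] by measurable

lemma random_variable_history: "history k \<in> M \<rightarrow>\<^sub>M count_space UNIV"
proof (rule measurable_count_space_eq2_countable[THEN iffD2], intro conjI ballI)
  fix xs
  have "history k -` {xs} \<inter> space M = {\<omega> \<in> space M. length xs = Suc k \<and> (\<forall>i\<le>k. X i \<omega> = xs ! i)}"
    by (auto simp: history_eq_iff[symmetric])
  then show "history k -` {xs} \<inter> space M \<in> sets M" by simp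
qed auto

text \<open>For histories of probability zero, or lists of the wrong length, the transition property gives no
  information, but both sides vanish.\<close>

lemma emeasure_history_Suc:
  "emeasure M {\<omega> \<in> space M. history k \<omega> = xs \<and> X (Suc k) \<omega> = y} =
    emeasure M {\<omega> \<in> space M. history k \<omega> = xs} * ennreal (P (xs ! k) y)"
proof (cases "length xs = Suc k \<and> prob {\<omega> \<in> space M. history k \<omega> = xs} > 0")
  case True
  then have "prob {\<omega> \<in> space M. X (Suc k) \<omega> = y \<and> (\<forall>i\<le>k. X i \<omega> = xs ! i)}
      = prob {\<omega> \<in> space M. history k \<omega> = xs} * P (xs ! k) y"
    using transition_X[of k "\<lambda>i. xs ! i" y] by (auto simp: cond_prob_def history_eq_iff field_simps)
  with True show ?thesis
    by (simp add: emeasure_eq_measure history_eq_iff conj_commute ennreal_mult')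
next
  case False
  then have null: "emeasure M {\<omega> \<in> space M. history k \<omega> = xs} = 0"
    by (cases "length xs = Suc k") (simp_all add: emeasure_eq_measure history_eq_iff zero_less_measure_iff)
  have "{\<omega> \<in> space M. history k \<omega> = xs} \<in> sets M"
    using measurable_sets[OF random_variable_history, of "{xs}" k] by (simp add: vimage_def Int_def conj_commute)
  then have "emeasure M {\<omega> \<in> space M. history k \<omega> = xs \<and> X (Suc k) \<omega> = y}
      \<le> emeasure M {\<omega> \<in> space M. history k \<omega> = xs}"
    by (intro emeasure_mono) auto
  with null show ?thesis by simp
qed

text \<open>The law of one more step given the past, integrated: the next state may be averaged with the
  transition matrix, while any dependence on the history stays in place. Allowing this dependence
  makes it possible to restrict to the event that the chain has stayed in a set so far.\<close>

lemma nn_integral_one_step: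
  fixes f :: "'s list \<Rightarrow> 's \<Rightarrow> ennreal"
  shows "(\<integral>\<^sup>+\<omega>. f (history k \<omega>) (X (Suc k) \<omega>) \<partial>M) =
    (\<integral>\<^sup>+\<omega>. (\<integral>\<^sup>+y. ennreal (P (X k \<omega>) y) * f (history k \<omega>) y \<partial>count_space UNIV) \<partial>M)"
proof -
  let ?Z = "\<lambda>\<omega>. (history k \<omega>, X (Suc k) \<omega>)"
  have "?Z \<in> M \<rightarrow>\<^sub>M count_space UNIV \<Otimes>\<^sub>M count_space UNIV"
    using random_variable_history random_variable_X by (rule measurable_Pair)
  then have "?Z \<in> M \<rightarrow>\<^sub>M count_space UNIV"
    by (simp add: pair_measure_countable)
  then have "(\<integral>\<^sup>+\<omega>. f (history k \<omega>) (X (Suc k) \<omega>) \<partial>M) =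
      (\<integral>\<^sup>+z. emeasure M {\<omega> \<in> space M. ?Z \<omega> = z} * (case z of (xs, y) \<Rightarrow> f xs y) \<partial>count_space UNIV)"
    using nn_integral_countable_valued[of ?Z "\<lambda>(xs, y). f xs y"] by simp
  also have "\<dots> = (\<integral>\<^sup>+xs. \<integral>\<^sup>+y. emeasure M {\<omega> \<in> space M. history k \<omega> = xs} *
      (ennreal (P (xs ! k) y) * f xs y) \<partial>count_space UNIV \<partial>count_space UNIV)"
    by (subst nn_integral_fst_count_space[symmetric]) (simp add: emeasure_history_Suc mult.assoc)
  also have "\<dots> = (\<integral>\<^sup>+xs. emeasure M {\<omega> \<in> space M. history k \<omega> = xs} *
      (\<integral>\<^sup>+y. ennreal (P (xs ! k) y) * f xs y \<partial>count_space UNIV) \<partial>count_space UNIV)"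
    by (simp add: nn_integral_cmult)
  also have "\<dots> = (\<integral>\<^sup>+\<omega>. (\<integral>\<^sup>+y. ennreal (P (history k \<omega> ! k) y) * f (history k \<omega>) y \<partial>count_space UNIV) \<partial>M)"
    by (rule nn_integral_countable_valued[OF random_variable_history, symmetric])
  finally show ?thesis by (simp add: history_nth)
qed

abbreviation stays :: "nat \<Rightarrow> nat \<Rightarrow> 's set \<Rightarrow> 'a \<Rightarrow> bool" where
  "stays T L D \<omega> \<equiv> \<forall>i\<in>{T..T + L}. X i \<omega> \<in> D"

lemma measurable_X_mem [measurable]: "Measurable.pred M (\<lambda>\<omega>. X i \<omega> \<in> D)"
  using random_variable_X[of i] by measurable

lemma measurable_fun_X [measurable]: "(\<lambda>\<omega>. (h :: 's \<Rightarrow> ennreal) (X i \<omega>)) \<in> borel_measurable M"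
  using random_variable_X[of i] by measurable

lemma nn_integral_drift:
  fixes h :: "'s \<Rightarrow> ennreal"
  assumes drift: "\<And>x. (\<integral>\<^sup>+y. ennreal (P x y) * h y \<partial>count_space UNIV) \<le> h x + 1"
  shows "(\<integral>\<^sup>+\<omega>. h (X k \<omega>) \<partial>M) \<le> (\<integral>\<^sup>+\<omega>. h (X 0 \<omega>) \<partial>M) + of_nat k"
proof (induction k)
  case (Suc k)
  have "(\<integral>\<^sup>+\<omega>. h (X (Suc k) \<omega>) \<partial>M) =
      (\<integral>\<^sup>+\<omega>. (\<integral>\<^sup>+y. ennreal (P (X k \<omega>) y) * h y \<partial>count_space UNIV) \<partial>M)"
    by (rule nn_integral_one_step)
  also have "\<dots> \<le> (\<integral>\<^sup>+\<omega>. h (X k \<omega>) + 1 \<partial>M)"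
    by (intro nn_integral_mono drift)
  also have "\<dots> = (\<integral>\<^sup>+\<omega>. h (X k \<omega>) \<partial>M) + 1"
    by (subst nn_integral_add) (auto simp: emeasure_space_1)
  also have "\<dots> \<le> ((\<integral>\<^sup>+\<omega>. h (X 0 \<omega>) \<partial>M) + of_nat k) + 1"
    by (intro add_right_mono Suc.IH)
  finally show ?case by (simp add: algebra_simps)
qed simp

text \<open>At each time \<open>T + j\<close> at which the chain has not yet left \<open>D\<close>, the potential drops by 1 on average.
  The potential spent by time \<open>T + L\<close> is thus at least the sum of the probabilities of having stayed
  until \<open>T + j\<close>, each of which is at least the probability of staying all along. As potentials are
  nonnegative, no more can be spent than was there at time \<open>T\<close>. The chain cannot stay
  if it is outside \<open>D\<close> at time \<open>T\<close>, hence the indicator on the right.\<close>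

lemma foster_staying_bound:
  fixes V :: "'s \<Rightarrow> ennreal"
  assumes drift: "\<And>x. x \<in> D \<Longrightarrow> (\<integral>\<^sup>+y. ennreal (P x y) * V y \<partial>count_space UNIV) + 1 \<le> V x"
  shows "of_nat L * emeasure M {\<omega> \<in> space M. stays T L D \<omega>} \<le>
    (\<integral>\<^sup>+\<omega>. V (X T \<omega>) * indicator D (X T \<omega>) \<partial>M)"
proof -
  define g where "g j = emeasure M {\<omega> \<in> space M. stays T j D \<omega>}" for j
  define u where "u j = (\<integral>\<^sup>+\<omega>. V (X (T + j) \<omega>) * indicator {\<omega>. stays T j D \<omega>} \<omega> \<partial>M)" for j
  have step: "u (Suc j) + g j \<le> u j" for j
  proof -
    let ?A = "indicator {\<omega>. stays T j D \<omega>} :: 'a \<Rightarrow> ennreal"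
    let ?Q = "indicator {xs. \<forall>i\<in>{T..T + j}. xs ! i \<in> D} :: 's list \<Rightarrow> ennreal"
    have Q: "?Q (history (T + j) \<omega>) = ?A \<omega>" for \<omega>
      by (auto simp: indicator_def history_nth)
    have A [measurable]: "?A \<in> borel_measurable M"
      by measurable
    have "u (Suc j) \<le> (\<integral>\<^sup>+\<omega>. V (X (Suc (T + j)) \<omega>) * ?A \<omega> \<partial>M)"
      unfolding u_def by (intro nn_integral_mono) (auto simp: indicator_def)
    also have "\<dots> = (\<integral>\<^sup>+\<omega>. (\<integral>\<^sup>+y. ennreal (P (X (T + j) \<omega>) y) * V y \<partial>count_space UNIV) * ?A \<omega> \<partial>M)"
      using nn_integral_one_step[of "\<lambda>xs y. V y * ?Q xs" "T + j"]
      by (simp add: Q mult.assoc[symmetric] nn_integral_multc)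
    finally have "u (Suc j) \<le>
        (\<integral>\<^sup>+\<omega>. (\<integral>\<^sup>+y. ennreal (P (X (T + j) \<omega>) y) * V y \<partial>count_space UNIV) * ?A \<omega> \<partial>M)" .
    moreover have "g j = (\<integral>\<^sup>+\<omega>. ?A \<omega> \<partial>M)"
    proof -
      have "g j = (\<integral>\<^sup>+\<omega>. indicator {\<omega> \<in> space M. stays T j D \<omega>} \<omega> \<partial>M)"
        unfolding g_def by (rule nn_integral_indicator[symmetric]) measurable
      also have "\<dots> = (\<integral>\<^sup>+\<omega>. ?A \<omega> \<partial>M)"
        by (intro nn_integral_cong) (simp add: indicator_def)
      finally show ?thesis .
    qed
    ultimately have "u (Suc j) + g j \<le>
        (\<integral>\<^sup>+\<omega>. (\<integral>\<^sup>+y. ennreal (P (X (T + j) \<omega>) y) * V y \<partial>count_space UNIV) * ?A \<omega> \<partial>M) + (\<integral>\<^sup>+\<omega>. ?A \<omega> \<partial>M)"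
      by (simp add: add_right_mono)
    also have "\<dots> = (\<integral>\<^sup>+\<omega>. ((\<integral>\<^sup>+y. ennreal (P (X (T + j) \<omega>) y) * V y \<partial>count_space UNIV) + 1) * ?A \<omega> \<partial>M)"
      by (subst nn_integral_add[symmetric]) (auto simp: distrib_right)
    also have "\<dots> \<le> u j"
      unfolding u_def by (intro nn_integral_mono) (auto simp: indicator_def intro!: drift)
    finally show ?thesis .
  qed
  have "u j + of_nat j * g L \<le> u 0" if "j \<le> L" for j
    using that
  proof (induction j)
    case (Suc j)
    have "g L \<le> g j"
      unfolding g_def using Suc.prems by (intro emeasure_mono) (auto intro: bspec)
    then have "u (Suc j) + of_nat (Suc j) * g L \<le> (u (Suc j) + g j) + of_nat j * g L"
      by (simp add: algebra_simps add_mono)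
    also have "\<dots> \<le> u j + of_nat j * g L"
      by (intro add_right_mono step)
    also have "\<dots> \<le> u 0"
      using Suc by simp
    finally show ?case .
  qed simp
  from this[of L] have "of_nat L * g L \<le> u 0"
    by (auto intro: order_trans[rotated])
  also have "u 0 = (\<integral>\<^sup>+\<omega>. V (X T \<omega>) * indicator D (X T \<omega>) \<partial>M)"
    unfolding u_def by (intro nn_integral_cong) (auto simp: indicator_def)
  finally show ?thesis by (simp add: g_def)
qed

end

section \<open>One step of the cat and of the mouse\<close>

text \<open>Truncated subtraction turns the step down from \<open>0\<close> into the step that stays at \<open>0\<close>, so the reflection
  needs no separate case.\<close>

lemma nn_integral_reflected_walk:
  fixes h :: "nat \<Rightarrow> ennreal"
  shows "(\<integral>\<^sup>+z. ennreal (reflected_walk p x z) * h z \<partial>count_space UNIV) =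
    ennreal p * h (x + 1) + ennreal (1 - p) * h (x - 1)"
proof -
  have "(\<integral>\<^sup>+z. ennreal (reflected_walk p x z) * h z \<partial>count_space UNIV) =
      (\<Sum>z\<in>{x + 1, x - 1}. ennreal (reflected_walk p x z) * h z)"
    by (rule nn_integral_count_space') (auto simp: reflected_walk_def)
  then show ?thesis
    by (auto simp: reflected_walk_def)
qed

lemma nn_integral_cat_mouse_apart:
  fixes h :: "'s::countable \<times> 's \<Rightarrow> ennreal"
  assumes "c \<noteq> m"
  shows "(\<integral>\<^sup>+y. ennreal (cat_mouse P (c, m) y) * h y \<partial>count_space UNIV) =
    (\<integral>\<^sup>+z. ennreal (P c z) * h (z, m) \<partial>count_space UNIV)"
proof -
  have "(\<integral>\<^sup>+w. ennreal (cat_mouse P (c, m) (z, w)) * h (z, w) \<partial>count_space UNIV) =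
      ennreal (P c z) * h (z, m)" for z
    using assms by (subst nn_integral_count_space'[of "{m}"]) (auto simp: cat_mouse_def)
  then show ?thesis
    by (subst nn_integral_fst_count_space[symmetric]) simp
qed

lemma nn_integral_cat_mouse_together:
  fixes h :: "'s::countable \<times> 's \<Rightarrow> ennreal"
  assumes "\<And>x y. 0 \<le> P x y"
  shows "(\<integral>\<^sup>+y. ennreal (cat_mouse P (m, m) y) * h y \<partial>count_space UNIV) =
    (\<integral>\<^sup>+z. ennreal (P m z) * (\<integral>\<^sup>+w. ennreal (P m w) * h (z, w) \<partial>count_space UNIV) \<partial>count_space UNIV)"
  using assms
  by (subst nn_integral_fst_count_space[symmetric])
    (simp add: cat_mouse_def ennreal_mult mult.assoc nn_integral_cmult)

lemma nn_integral_cat_mouse_reflected_walk: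
  fixes f :: "nat \<Rightarrow> nat \<Rightarrow> real"
  assumes "0 \<le> p" "p \<le> 1" and f: "\<And>z w. w \<le> m + 1 \<Longrightarrow> 0 \<le> f z w"
  shows "(\<integral>\<^sup>+y. ennreal (cat_mouse (reflected_walk p) (c, m) y) * ennreal (case y of (z, w) \<Rightarrow> f z w)
      \<partial>count_space UNIV) =
    ennreal (if c = m
      then p * (p * f (m + 1) (m + 1) + (1 - p) * f (m + 1) (m - 1))
        + (1 - p) * (p * f (m - 1) (m + 1) + (1 - p) * f (m - 1) (m - 1))
      else p * f (c + 1) m + (1 - p) * f (c - 1) m)"
proof -
  have mix: "ennreal p * ennreal u + ennreal (1 - p) * ennreal v = ennreal (p * u + (1 - p) * v)"
    if "0 \<le> u" "0 \<le> v" for u v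
    using that assms(1,2) by (subst ennreal_plus) (auto simp: ennreal_mult)
  have mix_nonneg: "0 \<le> p * u + (1 - p) * v" if "0 \<le> u" "0 \<le> v" for u v
    using that assms(1,2) by simp
  have f': "0 \<le> f z (m + 1)" "0 \<le> f z m" "0 \<le> f z (m - 1)" for z
    by (auto intro: f)
  show ?thesis
  proof (cases "c = m")
    case True
    have nonneg: "0 \<le> reflected_walk p x y" for x y
      using assms(1,2) by (simp add: reflected_walk_def)
    have "(\<integral>\<^sup>+y. ennreal (cat_mouse (reflected_walk p) (m, m) y) * ennreal (case y of (z, w) \<Rightarrow> f z w)
        \<partial>count_space UNIV) =
      ennreal (p * (p * f (m + 1) (m + 1) + (1 - p) * f (m + 1) (m - 1))
        + (1 - p) * (p * f (m - 1) (m + 1) + (1 - p) * f (m - 1) (m - 1)))"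
      unfolding nn_integral_cat_mouse_together[OF nonneg] nn_integral_reflected_walk prod.case
      by (simp only: mix mix_nonneg f')
    with True show ?thesis by simp
  next
    case False
    have "(\<integral>\<^sup>+y. ennreal (cat_mouse (reflected_walk p) (c, m) y) * ennreal (case y of (z, w) \<Rightarrow> f z w)
        \<partial>count_space UNIV) = ennreal (p * f (c + 1) m + (1 - p) * f (c - 1) m)"
      unfolding nn_integral_cat_mouse_apart[OF False] nn_integral_reflected_walk prod.case
      by (simp only: mix f')
    with False show ?thesis by simp
  qed
qed

section \<open>A potential for the climb of the mouse\<close>

text \<open>Among all \<open>r > 1\<close>, the bound \<open>r > (1 - p) / p\<close> selects those for which \<open>r ^ x\<close> grows on average by a
  fixed factor at each step of the walk: at the value \<open>(1 - p) / p\<close> itself, \<open>r ^ x\<close> is harmonic away from \<open>0\<close>.\<close>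

locale climb_potential =
  fixes p r :: real
  assumes p_pos: "0 < p" and p_less_half: "p < 1 / 2" and r_large: "(1 - p) / p < r"
begin

text \<open>The relative growth of \<open>r ^ x\<close> in one step of the walk from \<open>x > 0\<close>.\<close>

definition gain :: real where
  "gain = p * r + (1 - p) / r - 1"

definition climb_coeff :: real where
  "climb_coeff = 1 / gain"

text \<open>The inverse of the speed at which the cat goes down.\<close>

definition descent_coeff :: real where
  "descent_coeff = 1 / (1 - 2 * p)"

text \<open>Times \<open>gain\<close>, this is the sum of three debts at a meeting, in units of \<open>r ^ m\<close>: the time step itself,
  the chase if the mouse goes up and the cat down, and the chase if the mouse goes down and the cat
  up.\<close>

definition mouse_coeff :: real where
  "mouse_coeff = (1 + climb_coeff * r + 2 * descent_coeff) / gain"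

text \<open>An upper bound for the expected time that the cat at \<open>c\<close> needs to reach the mouse at \<open>m\<close>.\<close>

definition chase :: "nat \<Rightarrow> nat \<Rightarrow> real" where
  "chase c m = (if c \<le> m then climb_coeff * (r ^ m - r ^ c) else descent_coeff * (real c - real m))"

definition potential :: "nat \<Rightarrow> nat \<Rightarrow> nat \<Rightarrow> real" where
  "potential N c m = mouse_coeff * (r ^ N - r ^ m) + chase c m"

lemma r_gt_1: "1 < r"
proof -
  have "1 < (1 - p) / p" using p_pos p_less_half by (simp add: field_simps)
  with r_large show ?thesis by simp
qed

lemma gain_pos: "0 < gain"
proof -
  have "0 < (r - 1) * (p * r - (1 - p)) / r"
    using r_gt_1 r_large p_pos
    by (intro divide_pos_pos mult_pos_pos) (auto simp: pos_divide_less_eq mult.commute)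
  also have "\<dots> = gain"
    using r_gt_1 by (simp add: gain_def field_simps)
  finally show ?thesis .
qed

lemma climb_coeff_pos: "0 < climb_coeff"
  using gain_pos by (simp add: climb_coeff_def)

lemma descent_coeff_pos: "0 < descent_coeff"
  using p_less_half by (simp add: descent_coeff_def)

lemma mouse_coeff_pos: "0 < mouse_coeff"
  unfolding mouse_coeff_def
  using gain_pos climb_coeff_pos descent_coeff_pos r_gt_1
  by (intro divide_pos_pos add_pos_pos mult_pos_pos) auto

lemma power_growth: "(1 + gain) * r ^ x \<le> p * r ^ (x + 1) + (1 - p) * r ^ (x - 1)"
proof (cases x)
  case 0
  have "(1 - p) / r \<le> 1 - p"
    using r_gt_1 p_less_half by (simp add: pos_divide_le_eq)
  with 0 show ?thesis by (simp add: gain_def)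
next
  case (Suc y)
  then show ?thesis using r_gt_1 by (simp add: gain_def field_simps)
qed

text \<open>Since \<open>r ^ x \<ge> 1\<close>, geometric growth implies growth by a constant amount per step, which is what the
  chase uses.\<close>

lemma power_growth_coeff:
  assumes "0 \<le> k"
  shows "k * r ^ x + k * gain \<le> k * (p * r ^ (x + 1) + (1 - p) * r ^ (x - 1))"
proof -
  have "1 \<le> r ^ x"
    using r_gt_1 by simp
  then have "gain \<le> gain * r ^ x"
    using gain_pos by simp
  then have "r ^ x + gain \<le> (1 + gain) * r ^ x"
    by (simp add: algebra_simps)
  also note power_growth
  finally show ?thesis
    using assms by (metis distrib_left mult_left_mono)
qed

lemma chase_nonneg: "0 \<le> chase c m"
  using climb_coeff_pos descent_coeff_pos r_gt_1
  by (simp add: chase_def power_increasing)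

lemma chase_drift:
  assumes "c \<noteq> m"
  shows "p * chase (c + 1) m + (1 - p) * chase (c - 1) m \<le> chase c m - 1"
proof (cases "c < m")
  case True
  have eqs: "chase (c + 1) m = climb_coeff * (r ^ m - r ^ (c + 1))"
    "chase (c - 1) m = climb_coeff * (r ^ m - r ^ (c - 1))"
    "chase c m = climb_coeff * (r ^ m - r ^ c)"
    using True less_imp_diff_less[OF True, of 1] by (simp_all add: chase_def)
  have "climb_coeff * gain = 1"
    using gain_pos by (simp add: climb_coeff_def)
  then have "climb_coeff * r ^ c + 1 \<le> climb_coeff * (p * r ^ (c + 1) + (1 - p) * r ^ (c - 1))"
    using power_growth_coeff[of climb_coeff c] climb_coeff_pos by simp
  moreover have "p * (k * (z - x)) + (1 - p) * (k * (z - y)) = k * z - k * (p * x + (1 - p) * y)"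
    for k x y z :: real
    by algebra
  ultimately show ?thesis
    unfolding eqs by (simp only: right_diff_distrib[of climb_coeff "r ^ m" "r ^ c"])
next
  case False
  with assms obtain k where k: "c = Suc k" "m \<le> k"
    by (cases c) auto
  have above: "chase x m = descent_coeff * (real x - real m)" if "m \<le> x" for x
    using that by (cases "x = m") (simp_all add: chase_def)
  define D where "D = chase c m"
  have "D = descent_coeff * (real k - real m) + descent_coeff"
    unfolding D_def using k above[of c] by (simp add: distrib_left right_diff_distrib)
  moreover have "chase (c + 1) m = descent_coeff * (real k - real m) + 2 * descent_coeff"
    using k above[of "c + 1"] by (simp add: distrib_left right_diff_distrib)
  moreover have "chase (c - 1) m = descent_coeff * (real k - real m)"
    using k above[of k] by simp
  ultimately have eqs: "chase (c + 1) m = D + descent_coeff" "chase (c - 1) m = D - descent_coeff"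
    by simp_all
  have "p * (D + descent_coeff) + (1 - p) * (D - descent_coeff) = D - descent_coeff * (1 - 2 * p)"
    by algebra
  moreover have "descent_coeff * (1 - 2 * p) = 1"
    using p_less_half by (simp add: descent_coeff_def)
  ultimately show ?thesis
    unfolding eqs D_def[symmetric] by simp
qed

lemma potential_nonneg: "m \<le> N \<Longrightarrow> 0 \<le> potential N c m"
  using mouse_coeff_pos r_gt_1 chase_nonneg[of c m]
  by (simp add: potential_def power_increasing)

lemma potential_le:
  assumes "m \<le> N"
  shows "potential N c m \<le> (mouse_coeff + climb_coeff) * r ^ N + descent_coeff * real c"
proof -
  have "r ^ m \<le> r ^ N" "0 < r ^ m" "0 < r ^ c"
    using assms r_gt_1 by (auto intro: power_increasing)
  then have "climb_coeff * (r ^ m - r ^ c) \<le> climb_coeff * r ^ N"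
    "mouse_coeff * (r ^ N - r ^ m) \<le> mouse_coeff * r ^ N" "0 \<le> climb_coeff * r ^ N"
    using climb_coeff_pos mouse_coeff_pos by (auto intro!: mult_left_mono)
  moreover have "descent_coeff * (real c - real m) \<le> descent_coeff * real c" "0 \<le> descent_coeff * real c"
    using descent_coeff_pos by (auto intro!: mult_left_mono)
  ultimately show ?thesis
    by (auto simp: potential_def chase_def distrib_right)
qed

lemma potential_drift_apart:
  assumes "c \<noteq> m"
  shows "p * potential N (c + 1) m + (1 - p) * potential N (c - 1) m \<le> potential N c m - 1"
  using chase_drift[OF assms] by (simp add: potential_def algebra_simps)

text \<open>If cat and mouse step in the same direction, they are together again and no chase is needed. In the
  other two cases, each of probability \<open>p * (1 - p)\<close>, a chase over a distance of at most 2 begins; its cost is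
  covered by the gain of the term \<open>r ^ m\<close> under the step of the mouse.\<close>

lemma potential_drift_together:
  "p * (p * potential N (m + 1) (m + 1) + (1 - p) * potential N (m + 1) (m - 1))
    + (1 - p) * (p * potential N (m - 1) (m + 1) + (1 - p) * potential N (m - 1) (m - 1))
    \<le> potential N m m - 1"
proof -
  let ?gap = "chase (m - 1) (m + 1) + chase (m + 1) (m - 1)"
  let ?k = "climb_coeff * r + 2 * descent_coeff"
  have "1 \<le> r ^ m"
    using r_gt_1 by simp
  have "chase (m - 1) (m + 1) \<le> climb_coeff * r ^ (m + 1)"
    using climb_coeff_pos r_gt_1 by (auto simp: chase_def intro!: mult_left_mono)
  moreover have "chase (m + 1) (m - 1) \<le> 2 * descent_coeff"
    using descent_coeff_pos by (cases m) (auto simp: chase_def)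
  moreover have "2 * descent_coeff \<le> 2 * descent_coeff * r ^ m"
    using descent_coeff_pos \<open>1 \<le> r ^ m\<close> by simp
  ultimately have gap: "?gap \<le> ?k * r ^ m"
    by (simp add: algebra_simps)
  have "p * (1 - p) \<le> 1"
    using mult_le_one[of p "1 - p"] p_pos p_less_half by simp
  then have "p * (1 - p) * ?gap \<le> 1 * ?gap"
    by (intro mult_right_mono add_nonneg_nonneg chase_nonneg)
  with gap \<open>1 \<le> r ^ m\<close> have meeting: "p * (1 - p) * ?gap + 1 \<le> (1 + ?k) * r ^ m"
    by (simp add: algebra_simps)
  have "mouse_coeff * ((1 + gain) * r ^ m) \<le> mouse_coeff * (p * r ^ (m + 1) + (1 - p) * r ^ (m - 1))"
    using mouse_coeff_pos by (intro mult_left_mono power_growth) simp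
  moreover have "mouse_coeff * gain = 1 + ?k"
    using gain_pos by (simp add: mouse_coeff_def)
  then have "mouse_coeff * ((1 + gain) * r ^ m) = mouse_coeff * r ^ m + (1 + ?k) * r ^ m"
    by (simp only: distrib_right distrib_left mult.assoc[symmetric])
  ultimately have balance: "mouse_coeff * r ^ m + p * (1 - p) * ?gap + 1
      \<le> mouse_coeff * (p * r ^ (m + 1) + (1 - p) * r ^ (m - 1))"
    using meeting by simp
  have chase_0: "chase x x = 0" for x
    by (simp add: chase_def)
  \<comment> \<open>The level terms only see the marginal step of the mouse, with total weights \<open>p\<close> and \<open>1 - p\<close>.\<close>
  have "p * (p * (k * (R - x) + 0) + (1 - p) * (k * (R - y) + h))
      + (1 - p) * (p * (k * (R - x) + g) + (1 - p) * (k * (R - y) + 0))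
      = k * R - k * (p * x + (1 - p) * y) + p * (1 - p) * (g + h)" for k R x y g h :: real
    by algebra
  then have "p * (p * potential N (m + 1) (m + 1) + (1 - p) * potential N (m + 1) (m - 1))
      + (1 - p) * (p * potential N (m - 1) (m + 1) + (1 - p) * potential N (m - 1) (m - 1))
      = mouse_coeff * r ^ N - mouse_coeff * (p * r ^ (m + 1) + (1 - p) * r ^ (m - 1)) + p * (1 - p) * ?gap"
    unfolding potential_def chase_0 .
  also have "\<dots> \<le> mouse_coeff * r ^ N - mouse_coeff * r ^ m - 1"
    using balance by linarith
  also have "\<dots> = potential N m m - 1"
    by (simp add: potential_def chase_0 right_diff_distrib)
  finally show ?thesis .
qed

text \<open>Above level \<open>N\<close> the potential may be negative, and \<open>ennreal\<close> would cut it off at zero. From below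
  level \<open>N\<close> the chain reaches at most level \<open>N\<close>, where the potential is still nonnegative, so the cut
  does not affect the drift.\<close>

lemma potential_drift:
  assumes "m < N"
  shows "(\<integral>\<^sup>+y. ennreal (cat_mouse (reflected_walk p) (c, m) y) * ennreal (case y of (z, w) \<Rightarrow> potential N z w)
      \<partial>count_space UNIV) + 1 \<le> ennreal (potential N c m)"
proof -
  let ?s = "if c = m
      then p * (p * potential N (m + 1) (m + 1) + (1 - p) * potential N (m + 1) (m - 1))
        + (1 - p) * (p * potential N (m - 1) (m + 1) + (1 - p) * potential N (m - 1) (m - 1))
      else p * potential N (c + 1) m + (1 - p) * potential N (c - 1) m"
  have nonneg: "0 \<le> potential N z w" if "w \<le> m + 1" for z w
    using that assms by (intro potential_nonneg) simp
  have "0 \<le> ?s"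
    using p_pos p_less_half by (auto intro!: add_nonneg_nonneg mult_nonneg_nonneg nonneg)
  from ennreal_plus[OF this zero_le_one] have "ennreal ?s + 1 = ennreal (?s + 1)"
    by (simp only: ennreal_1)
  also have "\<dots> \<le> ennreal (potential N c m)"
    using potential_drift_together[of N m] potential_drift_apart[of c m N]
    by (intro ennreal_leI) auto
  also have "ennreal ?s = (\<integral>\<^sup>+y. ennreal (cat_mouse (reflected_walk p) (c, m) y)
      * ennreal (case y of (z, w) \<Rightarrow> potential N z w) \<partial>count_space UNIV)"
    by (rule nn_integral_cat_mouse_reflected_walk[symmetric]) (use p_pos p_less_half nonneg in auto)
  finally show ?thesis .
qed

end

section \<open>The cat and the mouse in a time window\<close>

text \<open>The cat alone is a reflected walk with downward drift, so the square of its height grows on average by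
  at most 1 per step.\<close>

lemma cat_second_moment:
  fixes p :: real and \<Omega> :: "'a measure" and C M :: "nat \<Rightarrow> 'a \<Rightarrow> nat"
  assumes "0 < p" "p < 1 / 2"
    and chain: "discrete_markov_chain \<Omega> (cat_mouse (reflected_walk p)) (\<lambda>k \<omega>. (C k \<omega>, M k \<omega>))"
    and start: "AE \<omega> in \<Omega>. C 0 \<omega> = 0"
  shows "(\<integral>\<^sup>+\<omega>. ennreal ((real (C T \<omega>))\<^sup>2) \<partial>\<Omega>) \<le> ennreal (real T)"
proof -
  interpret discrete_markov_chain \<Omega> "cat_mouse (reflected_walk p)" "\<lambda>k \<omega>. (C k \<omega>, M k \<omega>)"
    by (rule chain)
  let ?h = "\<lambda>c m :: nat. (real c)\<^sup>2"
  have up_down: "p * (real (c + 1))\<^sup>2 + (1 - p) * (real (c - 1))\<^sup>2 \<le> (real c)\<^sup>2 + 1" for c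
    using assms(1,2) mult_right_mono[of "2 * p" 1 "real c"]
    by (cases c) (auto simp: power2_eq_square algebra_simps)
  have "(\<integral>\<^sup>+y. ennreal (cat_mouse (reflected_walk p) x y) * ennreal (case y of (z, w) \<Rightarrow> ?h z w) \<partial>count_space UNIV)
      \<le> ennreal (case x of (z, w) \<Rightarrow> ?h z w) + 1" for x
  proof -
    obtain c m where x: "x = (c, m)" by fastforce
    have "(\<integral>\<^sup>+y. ennreal (cat_mouse (reflected_walk p) x y) * ennreal (case y of (z, w) \<Rightarrow> ?h z w) \<partial>count_space UNIV)
        = ennreal (p * (real (c + 1))\<^sup>2 + (1 - p) * (real (c - 1))\<^sup>2)"
      unfolding x using assms(1,2)
      by (subst nn_integral_cat_mouse_reflected_walk[where f = ?h]) (auto simp flip: distrib_right)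
    also have "\<dots> \<le> ennreal ((real c)\<^sup>2 + 1)"
      by (intro ennreal_leI up_down)
    finally show ?thesis
      by (simp add: x)
  qed
  from nn_integral_drift[OF this, of T]
  have "(\<integral>\<^sup>+\<omega>. ennreal ((real (C T \<omega>))\<^sup>2) \<partial>\<Omega>) \<le> (\<integral>\<^sup>+\<omega>. ennreal ((real (C 0 \<omega>))\<^sup>2) \<partial>\<Omega>) + of_nat T"
    by simp
  also have "(\<integral>\<^sup>+\<omega>. ennreal ((real (C 0 \<omega>))\<^sup>2) \<partial>\<Omega>) = (\<integral>\<^sup>+\<omega>. 0 \<partial>\<Omega>)"
    using start by (intro nn_integral_cong_AE) auto
  finally show ?thesis
    by (simp add: ennreal_of_nat_eq_real_of_nat)
qed

text \<open>In the Foster bound the height \<open>c\<close> of the cat enters linearly. It is controlled by the second moment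
  through \<open>c \<le> c ^ 2 / y + y\<close>; the choice \<open>y = r ^ N\<close> keeps the second term within the size of the
  potential that the mouse contributes anyway.\<close>

lemma (in climb_potential) mouse_stays_below:
  fixes \<Omega> :: "'a measure" and C M :: "nat \<Rightarrow> 'a \<Rightarrow> nat"
  assumes chain: "discrete_markov_chain \<Omega> (cat_mouse (reflected_walk p)) (\<lambda>k \<omega>. (C k \<omega>, M k \<omega>))"
    and start: "AE \<omega> in \<Omega>. C 0 \<omega> = 0"
  shows "real L * \<P>(\<omega> in \<Omega>. \<forall>i\<in>{T..T + L}. M i \<omega> < N)
    \<le> (mouse_coeff + climb_coeff + descent_coeff) * r ^ N + descent_coeff * (real T / r ^ N)"
proof -
  interpret discrete_markov_chain \<Omega> "cat_mouse (reflected_walk p)" "\<lambda>k \<omega>. (C k \<omega>, M k \<omega>)"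
    by (rule chain)
  let ?D = "{(c, m). m < N} :: (nat \<times> nat) set"
  let ?V = "\<lambda>x. ennreal (case x of (c, m) \<Rightarrow> potential N c m)"
  let ?K = "(mouse_coeff + climb_coeff + descent_coeff) * r ^ N"
  have rN: "0 < r ^ N"
    using r_gt_1 by simp
  have K: "0 \<le> ?K"
    using mouse_coeff_pos climb_coeff_pos descent_coeff_pos rN by simp
  have [measurable]: "C T \<in> \<Omega> \<rightarrow>\<^sub>M count_space UNIV"
    using measurable_compose[OF random_variable_X, of fst "count_space UNIV" T] by simp
  have V_le: "?V (c, m) * indicator ?D (c, m) \<le> ennreal ?K + ennreal (descent_coeff / r ^ N) * ennreal ((real c)\<^sup>2)"
    for c m
  proof (cases "m < N")
    case True
    have "real c * r ^ N \<le> (real c)\<^sup>2 + (r ^ N)\<^sup>2"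
    proof -
      have "0 \<le> real c * r ^ N" using rN by simp
      then show ?thesis using sum_squares_bound[of "real c" "r ^ N"] by linarith
    qed
    then have "real c \<le> ((real c)\<^sup>2 + (r ^ N)\<^sup>2) / r ^ N"
      using rN by (simp add: pos_le_divide_eq)
    also have "\<dots> = (real c)\<^sup>2 / r ^ N + r ^ N"
      using rN by (simp add: add_divide_distrib power2_eq_square)
    finally have "descent_coeff * real c \<le> descent_coeff * ((real c)\<^sup>2 / r ^ N + r ^ N)"
      using descent_coeff_pos by (intro mult_left_mono) auto
    with potential_le[of m N c] True
    have "potential N c m \<le> ?K + descent_coeff / r ^ N * (real c)\<^sup>2"
      by (simp add: algebra_simps)
    then have "?V (c, m) \<le> ennreal (?K + descent_coeff / r ^ N * (real c)\<^sup>2)"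
      by (auto intro: ennreal_leI)
    also have "\<dots> = ennreal ?K + ennreal (descent_coeff / r ^ N) * ennreal ((real c)\<^sup>2)"
      using K descent_coeff_pos rN by (simp only: ennreal_plus ennreal_mult'' zero_le_power2 zero_le_mult_iff
          zero_le_divide_iff less_imp_le simp_thms)
    finally show ?thesis using True by simp
  qed simp
  have "of_nat L * emeasure \<Omega> {\<omega> \<in> space \<Omega>. stays T L ?D \<omega>}
      \<le> (\<integral>\<^sup>+\<omega>. ?V (C T \<omega>, M T \<omega>) * indicator ?D (C T \<omega>, M T \<omega>) \<partial>\<Omega>)"
    by (rule foster_staying_bound) (auto intro: potential_drift)
  also have "\<dots> \<le> (\<integral>\<^sup>+\<omega>. ennreal ?K + ennreal (descent_coeff / r ^ N) * ennreal ((real (C T \<omega>))\<^sup>2) \<partial>\<Omega>)"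
    by (intro nn_integral_mono V_le)
  also have "\<dots> = ennreal ?K + ennreal (descent_coeff / r ^ N) * (\<integral>\<^sup>+\<omega>. ennreal ((real (C T \<omega>))\<^sup>2) \<partial>\<Omega>)"
    by (simp add: nn_integral_add nn_integral_cmult emeasure_space_1)
  also have "\<dots> \<le> ennreal ?K + ennreal (descent_coeff / r ^ N) * ennreal (real T)"
    using cat_second_moment[OF p_pos p_less_half chain start]
    by (intro add_left_mono mult_left_mono) auto
  also have "\<dots> = ennreal (?K + descent_coeff * (real T / r ^ N))"
    using K descent_coeff_pos rN by (simp add: ennreal_mult[symmetric] ennreal_plus[symmetric] del: ennreal_plus)
  finally have "ennreal (real L * \<P>(\<omega> in \<Omega>. \<forall>i\<in>{T..T + L}. M i \<omega> < N))
      \<le> ennreal (?K + descent_coeff * (real T / r ^ N))"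
    by (simp add: emeasure_eq_measure ennreal_of_nat_eq_real_of_nat ennreal_mult')
  then show ?thesis
    using K descent_coeff_pos rN by (subst (asm) ennreal_le_iff) auto
qed

text \<open>The left endpoint needs \<open>u = s\<close>, because \<open>\<lfloor>s * R\<rfloor> / R\<close> may lie to the left of \<open>s\<close>; any later integer
  \<open>k\<close> is attained at \<open>u = k / R\<close>.\<close>

lemma image_nat_floor_scaled_interval:
  fixes R s t :: real
  assumes "0 < R" "0 \<le> s" "s \<le> t"
  shows "(\<lambda>u. nat \<lfloor>u * R\<rfloor>) ` {s..t} = {nat \<lfloor>s * R\<rfloor>..nat \<lfloor>t * R\<rfloor>}"
proof (intro equalityI subsetI)
  fix k assume k: "k \<in> {nat \<lfloor>s * R\<rfloor>..nat \<lfloor>t * R\<rfloor>}"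
  show "k \<in> (\<lambda>u. nat \<lfloor>u * R\<rfloor>) ` {s..t}"
  proof (cases "k = nat \<lfloor>s * R\<rfloor>")
    case False
    with k have "nat \<lfloor>s * R\<rfloor> < k" "k \<le> nat \<lfloor>t * R\<rfloor>" by auto
    then have "s * R \<le> real k" "real k \<le> t * R"
      using assms by linarith+
    then have "real k / R \<in> {s..t}"
      using assms by (simp add: field_simps)
    moreover have "nat \<lfloor>real k / R * R\<rfloor> = k"
      using assms by simp
    ultimately show ?thesis by (metis image_eqI)
  qed (use assms in auto)
qed (use assms in \<open>auto intro!: nat_mono floor_mono mult_right_mono\<close>)

text \<open>The window contains finitely many times, so the supremum is attained. On naturals, being at least
  \<open>n / 2\<close> means being at least \<open>(n + 1) div 2\<close>.\<close>

lemma SUP_window_ge_half_iff: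
  fixes R s t :: real and f :: "nat \<Rightarrow> nat"
  assumes "0 < R" "0 \<le> s" "s \<le> t" "0 < n"
  shows "(SUP u\<in>{s..t}. real (f (nat \<lfloor>u * R\<rfloor>)) / real n) \<ge> 1 / 2 \<longleftrightarrow>
    (\<exists>i\<in>{nat \<lfloor>s * R\<rfloor>..nat \<lfloor>t * R\<rfloor>}. (n + 1) div 2 \<le> f i)"
proof -
  let ?I = "{nat \<lfloor>s * R\<rfloor>..nat \<lfloor>t * R\<rfloor>}"
  have "(\<lambda>u. real (f (nat \<lfloor>u * R\<rfloor>)) / real n) ` {s..t} = (\<lambda>i. real (f i) / real n) ` ?I"
    by (simp add: image_nat_floor_scaled_interval[OF assms(1-3), symmetric] image_image)
  moreover have "?I \<noteq> {}"
    using assms by (auto intro!: nat_mono floor_mono mult_right_mono)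
  moreover from this have "1 / 2 \<le> Max ((\<lambda>i. real (f i) / real n) ` ?I) \<longleftrightarrow>
      (\<exists>x\<in>(\<lambda>i. real (f i) / real n) ` ?I. 1 / 2 \<le> x)"
    by (intro Max_ge_iff) auto
  ultimately have "(SUP u\<in>{s..t}. real (f (nat \<lfloor>u * R\<rfloor>)) / real n) \<ge> 1 / 2 \<longleftrightarrow>
      (\<exists>i\<in>?I. 1 / 2 \<le> real (f i) / real n)"
    by (simp only: cSup_eq_Max finite_imageI finite_atLeastAtMost image_is_empty not_False_eq_True Set.bex_simps(7))
  moreover have "1 / 2 \<le> real k / real n \<longleftrightarrow> (n + 1) div 2 \<le> k" for k
    using assms by (simp add: field_simps) linarith
  ultimately show ?thesis by simp
qed

lemma filterlim_half_at_top: "filterlim (\<lambda>n::nat. (n + 1) div 2) at_top sequentially"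
  unfolding filterlim_at_top eventually_sequentially
proof (intro allI exI impI)
  fix Z n :: nat assume "2 * Z \<le> n"
  then show "Z \<le> (n + 1) div 2" by simp
qed

text \<open>With \<open>N = (n + 1) div 2\<close> one has \<open>2 * N \<le> n + 1\<close>, so the quotient is at most \<open>l * (r / l ^ 2) ^ N\<close>.\<close>

lemma power_half_over_power_tendsto_0:
  fixes r l :: real
  assumes "1 < r" "1 < l" "r < l\<^sup>2"
  shows "(\<lambda>n. r ^ ((n + 1) div 2) / l ^ n) \<longlonglongrightarrow> 0"
proof (rule Lim_null_comparison)
  have "(\<lambda>k. (r / l\<^sup>2) ^ k) \<longlonglongrightarrow> 0"
    using assms by (intro LIMSEQ_power_zero) simp
  from filterlim_compose[OF this filterlim_half_at_top]
  show "(\<lambda>n. l * (r / l\<^sup>2) ^ ((n + 1) div 2)) \<longlonglongrightarrow> 0"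
    by (rule tendsto_mult_right_zero)
  show "eventually (\<lambda>n. norm (r ^ ((n + 1) div 2) / l ^ n) \<le> l * (r / l\<^sup>2) ^ ((n + 1) div 2)) sequentially"
  proof (intro always_eventually allI)
    fix n :: nat
    let ?N = "(n + 1) div 2"
    have "l ^ (2 * ?N) \<le> l ^ (n + 1)"
      using assms by (intro power_increasing) auto
    then have "r ^ ?N / l ^ n \<le> l * (r ^ ?N / l ^ (2 * ?N))"
      using assms by (simp add: field_simps)
    then show "norm (r ^ ?N / l ^ n) \<le> l * (r / l\<^sup>2) ^ ?N"
      using assms by (simp add: power_divide power_mult)
  qed
qed

theorem proposition5:
  fixes p \<rho> s t :: real
    and \<Omega> :: "'a measure"
    and C M :: "nat \<Rightarrow> 'a \<Rightarrow> nat"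
  assumes "0 < p" and "p < 1 / 2"
    and "\<rho> = p / (1 - p)"
    and "discrete_markov_chain \<Omega> (cat_mouse (reflected_walk p)) (\<lambda>k \<omega>. (C k \<omega>, M k \<omega>))"
    and "AE \<omega> in \<Omega>. M 0 \<omega> = 0 \<and> C 0 \<omega> = 0"
    and "0 < s" and "s < t"
  shows "(\<lambda>n::nat. \<P>(\<omega> in \<Omega>.
      (SUP u\<in>{s..t}. real (M (nat \<lfloor>u * \<rho> powi (- int n)\<rfloor>) \<omega>) / real n) \<ge> 1 / 2))
    \<longlonglongrightarrow> 1"
proof -
  \<comment> \<open>The time scale is \<open>l ^ n\<close> with \<open>l = 1 / \<rho>\<close>.\<close>
  define l where "l = (1 - p) / p"
  have "1 < l"
    using assms(1,2) by (simp add: l_def field_simps)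
  then have "l < l\<^sup>2"
    by (simp add: power2_eq_square)
  then obtain r where r: "l < r" "r < l\<^sup>2"
    using dense by blast
  interpret climb_potential p r
    using assms(1,2) r by unfold_locales (auto simp: l_def)
  interpret discrete_markov_chain \<Omega> "cat_mouse (reflected_walk p)" "\<lambda>k \<omega>. (C k \<omega>, M k \<omega>)"
    by (rule assms(4))
  have start: "AE \<omega> in \<Omega>. C 0 \<omega> = 0"
    using assms(5) by eventually_elim simp
  have [measurable]: "M i \<in> \<Omega> \<rightarrow>\<^sub>M count_space UNIV" for i
    using measurable_compose[OF random_variable_X, of snd "count_space UNIV" i] by simp
  let ?N = "\<lambda>n::nat. (n + 1) div 2"
  let ?T = "\<lambda>n. nat \<lfloor>s * l ^ n\<rfloor>"
  let ?U = "\<lambda>n. nat \<lfloor>t * l ^ n\<rfloor>"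
  let ?S = "\<lambda>n. \<P>(\<omega> in \<Omega>. (SUP u\<in>{s..t}. real (M (nat \<lfloor>u * \<rho> powi (- int n)\<rfloor>) \<omega>) / real n) \<ge> 1 / 2)"
  let ?K = "mouse_coeff + climb_coeff + descent_coeff"
  \<comment> \<open>\<open>?e n\<close> is the bound of \<open>mouse_stays_below\<close> after division by \<open>l ^ n\<close>; the \<open>1 / l ^ n\<close> in its
    denominator is the loss from rounding the ends of the window.\<close>
  let ?e = "\<lambda>n. (?K * (r ^ ?N n / l ^ n) + descent_coeff * s * (1 / r ^ ?N n)) / (t - s - 1 / l ^ n)"
  have scale: "\<rho> powi (- int n) = l ^ n" for n
    using assms(3) by (simp add: l_def power_int_minus power_inverse[symmetric])
  have S: "?S n = 1 - \<P>(\<omega> in \<Omega>. \<forall>i\<in>{?T n..?U n}. M i \<omega> < ?N n)" if "0 < n" for n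
  proof -
    have "(SUP u\<in>{s..t}. real (M (nat \<lfloor>u * l ^ n\<rfloor>) \<omega>) / real n) \<ge> 1 / 2 \<longleftrightarrow>
        \<not> (\<forall>i\<in>{?T n..?U n}. M i \<omega> < ?N n)" for \<omega>
      using that assms(6,7) \<open>1 < l\<close> by (subst SUP_window_ge_half_iff) (auto simp: not_less)
    then have "?S n = \<P>(\<omega> in \<Omega>. \<not> (\<forall>i\<in>{?T n..?U n}. M i \<omega> < ?N n))"
      by (simp only: scale)
    also have "\<dots> = 1 - \<P>(\<omega> in \<Omega>. \<forall>i\<in>{?T n..?U n}. M i \<omega> < ?N n)"
      by (rule prob_neg) measurable
    finally show ?thesis .
  qed
  have l_lim: "(\<lambda>n. 1 / l ^ n) \<longlonglongrightarrow> 0"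
    using LIMSEQ_power_zero[of "1 / l"] \<open>1 < l\<close> by (simp add: power_divide)
  have "(\<lambda>k. 1 / r ^ k) \<longlonglongrightarrow> 0"
    using LIMSEQ_power_zero[of "1 / r"] r_gt_1 by (simp add: power_divide)
  from filterlim_compose[OF this filterlim_half_at_top] have r_lim: "(\<lambda>n. 1 / r ^ ?N n) \<longlonglongrightarrow> 0" .
  have "?e \<longlonglongrightarrow> (?K * 0 + descent_coeff * s * 0) / (t - s - 0)"
    using assms(7) r_gt_1 \<open>1 < l\<close> r
    by (intro tendsto_intros power_half_over_power_tendsto_0 r_lim l_lim) auto
  then have e_lim: "(\<lambda>n. 1 - ?e n) \<longlonglongrightarrow> 1"
    using tendsto_diff[OF tendsto_const[of 1], of ?e 0] by simp
  have "eventually (\<lambda>n. 1 / l ^ n < t - s) sequentially"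
    using order_tendstoD(2)[OF l_lim, of "t - s"] assms(7) by simp
  then have lower: "eventually (\<lambda>n. 1 - ?e n \<le> ?S n) sequentially"
    using eventually_gt_at_top[of 0]
  proof eventually_elim
    case (elim n)
    define R where "R = l ^ n"
    define L where "L = ?U n - ?T n"
    define stay where "stay = \<P>(\<omega> in \<Omega>. \<forall>i\<in>{?T n..?U n}. M i \<omega> < ?N n)"
    have R: "0 < R"
      using \<open>1 < l\<close> by (simp add: R_def)
    have TU: "?T n \<le> ?U n"
      using assms(7) R by (auto simp: R_def intro!: nat_mono floor_mono mult_right_mono)
    have T: "real (?T n) \<le> s * R"
      using assms(6) R by (simp add: R_def[symmetric])
    have "t * R - 1 \<le> real (?U n)"
      unfolding R_def[symmetric] by linarith
    then have L: "(t - s - 1 / R) * R \<le> real L"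
      using T TU R by (simp add: L_def of_nat_diff algebra_simps)
    have "0 \<le> stay"
      by (simp add: stay_def)
    then have "(t - s - 1 / R) * R * stay \<le> real L * stay"
      using L by (intro mult_right_mono)
    also have "\<dots> \<le> ?K * r ^ ?N n + descent_coeff * (real (?T n) / r ^ ?N n)"
      using mouse_stays_below[OF assms(4) start, of L "?T n" "?N n"] TU
      by (simp add: stay_def L_def)
    also have "\<dots> \<le> ?K * r ^ ?N n + descent_coeff * (s * R / r ^ ?N n)"
      using T descent_coeff_pos r_gt_1 by (intro add_left_mono mult_left_mono divide_right_mono) auto
    also have "\<dots> = (?K * (r ^ ?N n / R) + descent_coeff * s * (1 / r ^ ?N n)) * R"
    proof -
      have "x * y + z * (s * R / y) = (x * (y / R) + z * s * (1 / y)) * R" for x y z :: real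
        using R by (simp add: distrib_right)
      then show ?thesis .
    qed
    finally have "(t - s - 1 / R) * stay \<le> ?K * (r ^ ?N n / R) + descent_coeff * s * (1 / r ^ ?N n)"
      using R by (simp add: mult.assoc mult.commute[of R] flip: mult.assoc)
    then have "stay \<le> ?e n"
      using elim(1) by (simp add: R_def pos_le_divide_eq mult.commute)
    then show ?case
      using S[OF elim(2)] by (simp add: stay_def)
  qed
  show ?thesis
    using lower
    by (rule tendsto_sandwich[OF _ _ e_lim tendsto_const]) (simp add: prob_le_1)
qed

end
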